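(* Let $n\ge 1$, let $y,z\in\mathbb{R}^n$, and let $w_1,w_2\in\mathbb{R}^n$ be vectors with strictly positive components $w_{1,i},w_{2,i}$. Let $(a^*,b^* )$ be the unique minimizer of $$L_2(a,b)=\sum_{i=1}^n w_{1,i}(y_i-a_i)^2+\sum_{i=1}^n w_{2,i}(z_i-b_i)^2$$ over the set of pairs $(a,b)\in\mathbb{R}^n\times\mathbb{R}^n$ with $a_1\le\dots\le a_n$, $b_1\le\dots\le b_n$ and $a_i\le b_i$ for all $i$. Then $$a^*_1=\Big(\min_{1\le t\le n} Av_1(\{1,\dots,t\})\Big)\wedge\Big(\min_{1\le t'\le t\le n}\tilde M(\{1,\dots,t\},\{1,\dots,t'\})\Big)$$ and $$b^*_n=\Big(\max_{1\le t\le n} Av_2(\{t,\dots,n\})\Big)\vee\Big(\max_{1\le t\le t'\le n}\tilde M(\{t',\dots,n\},\{t,\dots,n\})\Big).$$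
   Context: For nonempty $A,B\subseteq\{1,\dots,n\}$, $$Av_1(A)=\frac{\sum_{i\in A}y_iw_{1,i}}{\sum_{i\in A}w_{1,i}},\qquad Av_2(A)=\frac{\sum_{i\in A}z_iw_{2,i}}{\sum_{i\in A}w_{2,i}},$$ $$\tilde M(A,B)=\frac{Av_1(A)\big(\sum_{i\in A}w_{1,i}\big)+Av_2(B)\big(\sum_{j\in B}w_{2,j}\big)}{\sum_{i\in A}w_{1,i}+\sum_{j\in B}w_{2,j}}.$$ For real numbers $x,x'$, $x\wedge x'=\min(x,x')$ and $x\vee x'=\max(x,x')$. The minimizer of $L_2$ over the stated set exists and is unique, since the set is closed and convex and $L_2$ is strictly convex. *)

theory Defs
  imports "HOL-Analysis.Analysis"
begin

text \<open>
  A vector of \<open>\<real>\<^sup>n\<close> is a function \<open>nat \<Rightarrow> real\<close> indexed by \<open>{1..n}\<close>. Data vectors are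
  only ever read on \<open>{1..n}\<close>. The vectors minimised over are extensional, i.e. elements
  of \<open>{1..n} \<rightarrow>\<^sub>E UNIV\<close>, so that each vector has exactly one representative and the
  minimiser is unique as a pair of functions.
\<close>

text \<open>\<open>Av\<^sub>1(A)\<close> is \<open>Av y w1 A\<close> and \<open>Av\<^sub>2(A)\<close> is \<open>Av z w2 A\<close>.\<close>

definition Av :: "(nat \<Rightarrow> real) \<Rightarrow> (nat \<Rightarrow> real) \<Rightarrow> nat set \<Rightarrow> real" where
  "Av v w A = (\<Sum>i\<in>A. v i * w i) / (\<Sum>i\<in>A. w i)"

definition M_tilde ::
  "(nat \<Rightarrow> real) \<Rightarrow> (nat \<Rightarrow> real) \<Rightarrow> (nat \<Rightarrow> real) \<Rightarrow> (nat \<Rightarrow> real) \<Rightarrow> nat set \<Rightarrow> nat set \<Rightarrow> real" where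
  "M_tilde y z w1 w2 A B =
     (Av y w1 A * (\<Sum>i\<in>A. w1 i) + Av z w2 B * (\<Sum>j\<in>B. w2 j)) /
     ((\<Sum>i\<in>A. w1 i) + (\<Sum>j\<in>B. w2 j))"

definition L2 ::
  "nat \<Rightarrow> (nat \<Rightarrow> real) \<Rightarrow> (nat \<Rightarrow> real) \<Rightarrow> (nat \<Rightarrow> real) \<Rightarrow> (nat \<Rightarrow> real) \<Rightarrow>
     (nat \<Rightarrow> real) \<times> (nat \<Rightarrow> real) \<Rightarrow> real" where
  "L2 n y z w1 w2 = (\<lambda>(a, b).
     (\<Sum>i=1..n. w1 i * (y i - a i)\<^sup>2) + (\<Sum>i=1..n. w2 i * (z i - b i)\<^sup>2))"

definition ordered_isotonic_pairs :: "nat \<Rightarrow> ((nat \<Rightarrow> real) \<times> (nat \<Rightarrow> real)) set" where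
  "ordered_isotonic_pairs n =
     {(a, b). a \<in> {1..n} \<rightarrow>\<^sub>E UNIV \<and> b \<in> {1..n} \<rightarrow>\<^sub>E UNIV \<and>
              mono_on {1..n} a \<and> mono_on {1..n} b \<and> (\<forall>i\<in>{1..n}. a i \<le> b i)}"

end

theory Submission
  imports Defs
begin

text \<open>
  The constraints say that the concatenation of \<open>a\<close> and \<open>b\<close> is isotone on a finite poset whose
  least element carries \<open>a 1\<close> and whose greatest element carries \<open>b n\<close>. Lowering the minimiser on
  a lower set \<open>{1..t} \<union> {1..t'}\<close> keeps it feasible, so the first-order condition shows that the
  weighted mean of the data on this set dominates that of the minimiser, hence \<open>a 1\<close>. The set
  where the minimiser equals \<open>a 1\<close> is itself a lower set, and the minimiser can also be raised
  slightly on it, so there equality holds. The formula for \<open>b n\<close> is the order dual. Empty index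
  sets are allowed in \<open>M_tilde\<close>, which absorbs the averages \<open>Av\<close>.
\<close>

section \<open>First-order conditions for the least-squares problem\<close>

lemma L2_restrict [simp]:
  "L2 n y z w1 w2 (restrict f {1..n}, restrict g {1..n}) = L2 n y z w1 w2 (f, g)"
  by (simp add: L2_def)

text \<open>Feasible vectors are extensional, whereas competitors are most easily written as total
  functions. Passing them through \<open>restrict\<close> makes them extensional without affecting
  \<open>L2\<close> or the order constraints.\<close>

lemma restrict_in_ordered_isotonic_pairs_iff:
  "(restrict f {1..n}, restrict g {1..n}) \<in> ordered_isotonic_pairs n \<longleftrightarrow>
     mono_on {1..n} f \<and> mono_on {1..n} g \<and> (\<forall>i\<in>{1..n}. f i \<le> g i)"
  by (auto simp: ordered_isotonic_pairs_def monotone_on_def)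

lemma mono_on_convex_combination:
  fixes f g :: "nat \<Rightarrow> real"
  assumes "mono_on A f" "mono_on A g" "0 \<le> s" "s \<le> 1"
  shows "mono_on A (\<lambda>i. f i + s * (g i - f i))"
proof (rule mono_onI)
  fix i j assume "i \<in> A" "j \<in> A" "i \<le> j"
  then have "(1 - s) * f i + s * g i \<le> (1 - s) * f j + s * g j"
    using assms by (intro add_mono mult_left_mono) (auto dest: mono_onD)
  then show "f i + s * (g i - f i) \<le> f j + s * (g j - f j)"
    by (simp add: algebra_simps)
qed

text \<open>The objective is quadratic, so its expansion along a ray is exact. This takes the place
  of a derivative: minimality is read off from a polynomial in \<open>s\<close>.\<close>

lemma L2_add_scaled:
  "L2 n y z w1 w2 (\<lambda>i. a i + s * c i, \<lambda>i. b i + s * d i) =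
     L2 n y z w1 w2 (a, b)
     - 2 * s * ((\<Sum>i=1..n. w1 i * (y i - a i) * c i) + (\<Sum>i=1..n. w2 i * (z i - b i) * d i))
     + s\<^sup>2 * ((\<Sum>i=1..n. w1 i * (c i)\<^sup>2) + (\<Sum>i=1..n. w2 i * (d i)\<^sup>2))"
proof -
  have "(\<Sum>i=1..n. w i * (v i - (x i + s * e i))\<^sup>2) =
      (\<Sum>i=1..n. w i * (v i - x i)\<^sup>2) - 2 * s * (\<Sum>i=1..n. w i * (v i - x i) * e i)
      + s\<^sup>2 * (\<Sum>i=1..n. w i * (e i)\<^sup>2)" for w v x e :: "nat \<Rightarrow> real"
    unfolding sum_distrib_left sum_subtractf[symmetric] sum.distrib[symmetric]
    by (intro sum.cong refl) (simp add: power2_eq_square algebra_simps)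
  then show ?thesis
    unfolding L2_def by (simp add: distrib_left)
qed

lemma nonpos_if_linear_le_quadratic:
  fixes D Q :: real
  assumes le: "\<And>s. 0 < s \<Longrightarrow> s \<le> 1 \<Longrightarrow> 2 * s * D \<le> s\<^sup>2 * Q"
  shows "D \<le> 0"
proof (rule ccontr)
  assume "\<not> D \<le> 0"
  then have D: "D > 0" by simp
  \<comment> \<open>Chosen so that \<open>s * (D + \<bar>Q\<bar>) = D\<close>. This step lies in
    (0,1] and forces \<open>s * Q \<le> D\<close>, against \<open>2 * D \<le> s * Q\<close>.\<close>
  define s where "s = D / (D + \<bar>Q\<bar>)"
  have s: "0 < s" "s \<le> 1" and eq: "s * (D + \<bar>Q\<bar>) = D"
    using D by (auto simp: s_def divide_simps)
  have "s * (2 * D) \<le> s * (s * Q)"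
    using le[OF s] by (simp add: power2_eq_square mult_ac)
  then have "2 * D \<le> s * Q"
    using s by simp
  also have "\<dots> \<le> s * (D + \<bar>Q\<bar>)"
    using s D by (intro mult_left_mono) auto
  finally show False
    using D eq by simp
qed

text \<open>The constraints are convex, so the whole segment from \<open>(a, b)\<close> to
  \<open>(f, g)\<close> satisfies them. Since \<open>L2\<close> does not drop below its value at
  \<open>(a, b)\<close> along the segment, the coefficient linear in \<open>s\<close> has a
  sign.\<close>

lemma L2_variational_inequality:
  assumes min: "is_arg_min (L2 n y z w1 w2) (\<lambda>p. p \<in> ordered_isotonic_pairs n) (a, b)"
    and f: "mono_on {1..n} f" and g: "mono_on {1..n} g"
    and fg: "\<And>i. i \<in> {1..n} \<Longrightarrow> f i \<le> g i"
  shows "(\<Sum>i=1..n. w1 i * (y i - a i) * (f i - a i)) +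
         (\<Sum>i=1..n. w2 i * (z i - b i) * (g i - b i)) \<le> 0"
proof (rule nonpos_if_linear_le_quadratic)
  fix s :: real assume s: "0 < s" "s \<le> 1"
  have ab: "mono_on {1..n} a" "mono_on {1..n} b" "\<And>i. i \<in> {1..n} \<Longrightarrow> a i \<le> b i"
    using min by (auto simp: is_arg_min_def ordered_isotonic_pairs_def)
  let ?f = "\<lambda>i. a i + s * (f i - a i)" and ?g = "\<lambda>i. b i + s * (g i - b i)"
  have "?f i \<le> ?g i" if "i \<in> {1..n}" for i
  proof -
    have "(1 - s) * a i + s * f i \<le> (1 - s) * b i + s * g i"
      using s ab(3)[OF that] fg[OF that] by (intro add_mono mult_left_mono) auto
    then show ?thesis
      by (simp add: algebra_simps)
  qed
  then have "(restrict ?f {1..n}, restrict ?g {1..n}) \<in> ordered_isotonic_pairs n"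
    unfolding restrict_in_ordered_isotonic_pairs_iff
    using s ab f g by (intro conjI ballI mono_on_convex_combination) simp_all
  then have "L2 n y z w1 w2 (a, b) \<le> L2 n y z w1 w2 (restrict ?f {1..n}, restrict ?g {1..n})"
    using min unfolding is_arg_min_linorder by blast
  then have "L2 n y z w1 w2 (a, b) \<le> L2 n y z w1 w2 (?f, ?g)"
    by (simp only: L2_restrict)
  then show "2 * s * ((\<Sum>i=1..n. w1 i * (y i - a i) * (f i - a i)) +
         (\<Sum>i=1..n. w2 i * (z i - b i) * (g i - b i)))
      \<le> s\<^sup>2 * ((\<Sum>i=1..n. w1 i * (f i - a i)\<^sup>2) + (\<Sum>i=1..n. w2 i * (g i - b i)\<^sup>2))"
    unfolding L2_add_scaled by linarith
qed

lemma sum_mult_of_bool: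
  fixes h :: "nat \<Rightarrow> real"
  assumes "A \<subseteq> {1..n}" and "\<And>i. i \<in> {1..n} \<Longrightarrow> d i = c * of_bool (i \<in> A)"
  shows "(\<Sum>i=1..n. h i * d i) = c * sum h A"
proof -
  have "(\<Sum>i=1..n. h i * d i) = (\<Sum>i=1..n. if i \<in> A then c * h i else 0)"
    using assms(2) by (intro sum.cong) auto
  also have "\<dots> = (\<Sum>i\<in>{1..n} \<inter> A. c * h i)"
    by (rule sum.inter_restrict[symmetric]) simp
  also have "{1..n} \<inter> A = A"
    using assms(1) by blast
  also have "(\<Sum>i\<in>A. c * h i) = c * sum h A"
    by (rule sum_distrib_left[symmetric])
  finally show ?thesis .
qed

text \<open>Directions that shift by one constant \<open>c\<close> on \<open>A\<close> and
  \<open>B\<close> isolate the residual sum over these sets; the sign of \<open>c\<close> decides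
  which inequality results. Keeping \<open>f\<close> and \<open>g\<close> as separate variables lets
  them be given in a form, such as a truncation, whose monotonicity is evident.\<close>

lemma L2_variational_inequality_indicator:
  assumes "is_arg_min (L2 n y z w1 w2) (\<lambda>p. p \<in> ordered_isotonic_pairs n) (a, b)"
    and "mono_on {1..n} f" "mono_on {1..n} g" "\<And>i. i \<in> {1..n} \<Longrightarrow> f i \<le> g i"
    and "A \<subseteq> {1..n}" "B \<subseteq> {1..n}"
    and "\<And>i. i \<in> {1..n} \<Longrightarrow> f i = a i + c * of_bool (i \<in> A)"
    and "\<And>i. i \<in> {1..n} \<Longrightarrow> g i = b i + c * of_bool (i \<in> B)"
  shows "c * ((\<Sum>i\<in>A. w1 i * (y i - a i)) + (\<Sum>i\<in>B. w2 i * (z i - b i))) \<le> 0"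
proof -
  have "(\<Sum>i=1..n. w1 i * (y i - a i) * (f i - a i)) = c * (\<Sum>i\<in>A. w1 i * (y i - a i))"
    "(\<Sum>i=1..n. w2 i * (z i - b i) * (g i - b i)) = c * (\<Sum>i\<in>B. w2 i * (z i - b i))"
    using assms(5-8) by (intro sum_mult_of_bool; simp)+
  with L2_variational_inequality[OF assms(1-4)] show ?thesis
    by (simp add: distrib_left)
qed

section \<open>Weighted means as sign conditions on residual sums\<close>

lemma Av_mult_sum:
  assumes "finite A" "\<And>i. i \<in> A \<Longrightarrow> w i > 0"
  shows "Av v w A * sum w A = (\<Sum>i\<in>A. v i * w i)"
proof (cases "A = {}")
  case False
  then have "sum w A > 0"
    using assms by (intro sum_pos) auto
  then show ?thesis
    by (simp add: Av_def)
qed simp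

text \<open>The average over the empty set is multiplied by total weight 0 and drops out. Thus the
  averages \<open>Av\<close> are boundary cases of \<open>M_tilde\<close>, and one argument handles
  both kinds of terms.\<close>

lemma M_tilde_empty:
  assumes "finite A"
  shows "(\<And>i. i \<in> A \<Longrightarrow> w1 i > 0) \<Longrightarrow> M_tilde y z w1 w2 A {} = Av y w1 A"
    and "(\<And>i. i \<in> A \<Longrightarrow> w2 i > 0) \<Longrightarrow> M_tilde y z w1 w2 {} A = Av z w2 A"
  using assms by (auto simp: M_tilde_def Av_mult_sum Av_def)

context
  fixes A B :: "nat set" and w1 w2 :: "nat \<Rightarrow> real"
  assumes fin: "finite A" "finite B" and ne: "A \<union> B \<noteq> {}"
    and pos: "\<And>i. i \<in> A \<Longrightarrow> w1 i > 0" "\<And>i. i \<in> B \<Longrightarrow> w2 i > 0"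
begin

text \<open>\<open>M_tilde\<close> is the weighted mean of the pooled data; multiplying by the
  positive total weight turns a comparison with \<open>m\<close> into the sign of the weighted
  residuals about \<open>m\<close>.\<close>

lemma M_tilde_le_iff:
  "M_tilde y z w1 w2 A B \<le> m \<longleftrightarrow>
     (\<Sum>i\<in>A. w1 i * (y i - m)) + (\<Sum>i\<in>B. w2 i * (z i - m)) \<le> 0"
  and le_M_tilde_iff:
  "m \<le> M_tilde y z w1 w2 A B \<longleftrightarrow>
     0 \<le> (\<Sum>i\<in>A. w1 i * (y i - m)) + (\<Sum>i\<in>B. w2 i * (z i - m))"
proof -
  have nonneg: "sum w1 A \<ge> 0" "sum w2 B \<ge> 0"
    using pos by (intro sum_nonneg less_imp_le; simp)+
  \<comment> \<open>Only the union is known to be nonempty, so positivity comes from whichever set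
    has an element.\<close>
  have W: "sum w1 A + sum w2 B > 0"
  proof (cases "A = {}")
    case True
    then have "sum w2 B > 0"
      using fin pos ne by (intro sum_pos) auto
    with nonneg show ?thesis by simp
  next
    case False
    then have "sum w1 A > 0"
      using fin pos by (intro sum_pos) auto
    with nonneg show ?thesis by simp
  qed
  have "(\<Sum>i\<in>C. w i * (v i - m)) = (\<Sum>i\<in>C. v i * w i) - m * sum w C"
    for C and w v :: "nat \<Rightarrow> real"
    by (simp add: sum_distrib_left sum_subtractf algebra_simps)
  moreover have "M_tilde y z w1 w2 A B =
      ((\<Sum>i\<in>A. y i * w1 i) + (\<Sum>i\<in>B. z i * w2 i)) / (sum w1 A + sum w2 B)"
    using fin pos by (simp add: M_tilde_def Av_mult_sum)
  ultimately show "M_tilde y z w1 w2 A B \<le> m \<longleftrightarrow>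
     (\<Sum>i\<in>A. w1 i * (y i - m)) + (\<Sum>i\<in>B. w2 i * (z i - m)) \<le> 0"
    and "m \<le> M_tilde y z w1 w2 A B \<longleftrightarrow>
     0 \<le> (\<Sum>i\<in>A. w1 i * (y i - m)) + (\<Sum>i\<in>B. w2 i * (z i - m))"
    using W by (simp_all only: pos_divide_le_eq pos_le_divide_eq distrib_left) linarith+
qed

text \<open>Replacing the fitted values by a common lower bound \<open>m\<close> can only increase
  the weighted residuals, so a nonnegative residual sum of the fit passes to
  \<open>m\<close>.\<close>

lemma le_M_tildeI:
  assumes "0 \<le> (\<Sum>i\<in>A. w1 i * (y i - a i)) + (\<Sum>i\<in>B. w2 i * (z i - b i))"
    and "\<And>i. i \<in> A \<Longrightarrow> m \<le> a i" "\<And>i. i \<in> B \<Longrightarrow> m \<le> b i"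
  shows "m \<le> M_tilde y z w1 w2 A B"
proof -
  have "(\<Sum>i\<in>A. w1 i * (y i - a i)) \<le> (\<Sum>i\<in>A. w1 i * (y i - m))"
    "(\<Sum>i\<in>B. w2 i * (z i - b i)) \<le> (\<Sum>i\<in>B. w2 i * (z i - m))"
    using assms(2,3) pos by (intro sum_mono mult_left_mono; simp add: less_imp_le)+
  with assms(1) show ?thesis
    unfolding le_M_tilde_iff by linarith
qed

lemma M_tilde_leI:
  assumes "(\<Sum>i\<in>A. w1 i * (y i - a i)) + (\<Sum>i\<in>B. w2 i * (z i - b i)) \<le> 0"
    and "\<And>i. i \<in> A \<Longrightarrow> a i \<le> m" "\<And>i. i \<in> B \<Longrightarrow> b i \<le> m"
  shows "M_tilde y z w1 w2 A B \<le> m"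
proof -
  have "(\<Sum>i\<in>A. w1 i * (y i - m)) \<le> (\<Sum>i\<in>A. w1 i * (y i - a i))"
    "(\<Sum>i\<in>B. w2 i * (z i - m)) \<le> (\<Sum>i\<in>B. w2 i * (z i - b i))"
    using assms(2,3) pos by (intro sum_mono mult_left_mono; simp add: less_imp_le)+
  with assms(1) show ?thesis
    unfolding M_tilde_le_iff by linarith
qed

end

section \<open>Gaps in finite sets of reals; initial and final segments\<close>

lemma finite_gap_above:
  fixes S :: "real set"
  assumes "finite S"
  obtains m where "x < m" "\<And>v. v \<in> S \<Longrightarrow> x < v \<Longrightarrow> m \<le> v"
proof -
  let ?T = "insert (x + 1) {v \<in> S. x < v}"
  have "x < Min ?T" "\<And>v. v \<in> S \<Longrightarrow> x < v \<Longrightarrow> Min ?T \<le> v"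
    using assms by (auto intro: Min_le)
  then show thesis
    by (rule that)
qed

lemma finite_gap_below:
  fixes S :: "real set"
  assumes "finite S"
  obtains m where "m < x" "\<And>v. v \<in> S \<Longrightarrow> v < x \<Longrightarrow> v \<le> m"
proof -
  let ?T = "insert (x - 1) {v \<in> S. v < x}"
  have "Max ?T < x" "\<And>v. v \<in> S \<Longrightarrow> v < x \<Longrightarrow> v \<le> Max ?T"
    using assms by (auto intro: Max_ge)
  then show thesis
    by (rule that)
qed

text \<open>The empty set is encoded by \<open>t = 0\<close>; this is what later separates the
  \<open>Av\<close> terms from the \<open>M_tilde\<close> terms.\<close>

lemma down_closed_eq_atLeastAtMost:
  fixes S :: "nat set"
  assumes "S \<subseteq> {1..n}" "\<And>i j. j \<in> S \<Longrightarrow> 1 \<le> i \<Longrightarrow> i \<le> j \<Longrightarrow> i \<in> S"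
  obtains t where "t \<le> n" "S = {1..t}"
proof (cases "S = {}")
  case True
  then show thesis using that[of 0] by simp
next
  case False
  have "finite S" using assms(1) finite_subset by blast
  with False have m: "Max S \<in> S" "\<And>i. i \<in> S \<Longrightarrow> i \<le> Max S" by auto
  then have "Max S \<in> {1..n}"
    using assms(1) by blast
  moreover have "S = {1..Max S}"
  proof
    show "S \<subseteq> {1..Max S}"
      using m(2) assms(1) by auto
    show "{1..Max S} \<subseteq> S"
      using assms(2)[OF m(1)] by auto
  qed
  ultimately show thesis
    using that[of "Max S"] by simp
qed

text \<open>Here the empty set is encoded by \<open>t = Suc n\<close>, which explains the upper
  bound on \<open>t\<close>.\<close>

lemma up_closed_eq_atLeastAtMost:
  fixes S :: "nat set"
  assumes "S \<subseteq> {1..n}" "\<And>i j. i \<in> S \<Longrightarrow> i \<le> j \<Longrightarrow> j \<le> n \<Longrightarrow> j \<in> S"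
  obtains t where "1 \<le> t" "t \<le> Suc n" "S = {t..n}"
proof (cases "S = {}")
  case True
  then show thesis using that[of "Suc n"] by simp
next
  case False
  have "finite S" using assms(1) finite_subset by blast
  with False have m: "Min S \<in> S" "\<And>i. i \<in> S \<Longrightarrow> Min S \<le> i" by auto
  then have "Min S \<in> {1..n}"
    using assms(1) by blast
  moreover have "S = {Min S..n}"
  proof
    show "S \<subseteq> {Min S..n}"
      using m(2) assms(1) by auto
    show "{Min S..n} \<subseteq> S"
      using assms(2)[OF m(1)] by auto
  qed
  ultimately show thesis
    using that[of "Min S"] by simp
qed

section \<open>Bounds on the extreme values of the minimiser, and their attainment\<close>

context
  fixes n :: nat and y z w1 w2 a b :: "nat \<Rightarrow> real"
  assumes n: "n \<ge> 1"
    and w1: "\<And>i. i \<in> {1..n} \<Longrightarrow> w1 i > 0"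
    and w2: "\<And>i. i \<in> {1..n} \<Longrightarrow> w2 i > 0"
    and arg_min: "is_arg_min (L2 n y z w1 w2) (\<lambda>p. p \<in> ordered_isotonic_pairs n) (a, b)"
begin

lemma
  shows mono_a: "1 \<le> i \<Longrightarrow> i \<le> j \<Longrightarrow> j \<le> n \<Longrightarrow> a i \<le> a j"
    and mono_b: "1 \<le> i \<Longrightarrow> i \<le> j \<Longrightarrow> j \<le> n \<Longrightarrow> b i \<le> b j"
    and a_le_b: "1 \<le> i \<Longrightarrow> i \<le> n \<Longrightarrow> a i \<le> b i"
proof -
  have "(a, b) \<in> ordered_isotonic_pairs n"
    using arg_min by (simp add: is_arg_min_def)
  then have "mono_on {1..n} a" "mono_on {1..n} b" "\<forall>i\<in>{1..n}. a i \<le> b i"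
    by (simp_all add: ordered_isotonic_pairs_def)
  then show "1 \<le> i \<Longrightarrow> i \<le> j \<Longrightarrow> j \<le> n \<Longrightarrow> a i \<le> a j"
    and "1 \<le> i \<Longrightarrow> i \<le> j \<Longrightarrow> j \<le> n \<Longrightarrow> b i \<le> b j"
    and "1 \<le> i \<Longrightarrow> i \<le> n \<Longrightarrow> a i \<le> b i"
    by (simp_all add: mono_onD)
qed

lemma a_first_le: "1 \<le> i \<Longrightarrow> i \<le> n \<Longrightarrow> a 1 \<le> a i" "1 \<le> i \<Longrightarrow> i \<le> n \<Longrightarrow> a 1 \<le> b i"
  using mono_a[of 1 i] a_le_b[of i] by auto

lemma le_b_last: "1 \<le> i \<Longrightarrow> i \<le> n \<Longrightarrow> a i \<le> b n" "1 \<le> i \<Longrightarrow> i \<le> n \<Longrightarrow> b i \<le> b n"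
  using mono_b[of i n] a_le_b[of i] by auto

text \<open>Lowering on an initial segment preserves monotonicity for any step size, so 1 serves. By
  \<open>t' \<le> t\<close>, \<open>a\<close> is lowered wherever \<open>b\<close> is, which
  preserves \<open>a \<le> b\<close>. The case \<open>t' = 0\<close> yields the bound by
  \<open>Av\<close>.\<close>

lemma a_first_le_M_tilde:
  assumes "t' \<le> t" "1 \<le> t" "t \<le> n"
  shows "a 1 \<le> M_tilde y z w1 w2 {1..t} {1..t'}"
proof -
  let ?f = "\<lambda>i. a i + (- 1) * of_bool (i \<in> {1..t})"
  let ?g = "\<lambda>i. b i + (- 1) * of_bool (i \<in> {1..t'})"
  have "(- 1) * ((\<Sum>i\<in>{1..t}. w1 i * (y i - a i)) + (\<Sum>i\<in>{1..t'}. w2 i * (z i - b i))) \<le> 0"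
  proof (rule L2_variational_inequality_indicator[OF arg_min, where f = ?f and g = ?g])
    show "mono_on {1..n} ?f"
    proof (rule mono_onI)
      fix i j assume "i \<in> {1..n}" "j \<in> {1..n}" "i \<le> j"
      then show "?f i \<le> ?f j"
        using mono_a[of i j] by (simp add: of_bool_def)
    qed
    show "mono_on {1..n} ?g"
    proof (rule mono_onI)
      fix i j assume "i \<in> {1..n}" "j \<in> {1..n}" "i \<le> j"
      then show "?g i \<le> ?g j"
        using mono_b[of i j] by (simp add: of_bool_def)
    qed
    show "?f i \<le> ?g i" if "i \<in> {1..n}" for i
      using that a_le_b[of i] assms(1) by (simp add: of_bool_def)
  qed (use assms in simp_all)
  then have sums: "0 \<le> (\<Sum>i\<in>{1..t}. w1 i * (y i - a i)) + (\<Sum>i\<in>{1..t'}. w2 i * (z i - b i))"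
    by (simp only: mult_minus1 neg_le_0_iff_le)
  show ?thesis
  proof (rule le_M_tildeI[OF _ _ _ _ _ sums])
    show "w1 i > 0" "a 1 \<le> a i" if "i \<in> {1..t}" for i
      using that assms w1[of i] a_first_le(1)[of i] by simp_all
    show "w2 i > 0" "a 1 \<le> b i" if "i \<in> {1..t'}" for i
      using that assms w2[of i] a_first_le(2)[of i] by simp_all
  qed (use assms in simp_all)
qed

text \<open>Dually, final segments are raised by 1, and \<open>t \<le> t'\<close> ensures that
  \<open>b\<close> rises wherever \<open>a\<close> does. A \<open>t'\<close> beyond \<open>n\<close>
  makes the first segment empty and yields the bound by \<open>Av\<close>.\<close>

lemma M_tilde_le_b_last:
  assumes "t \<le> t'" "1 \<le> t" "t \<le> n"
  shows "M_tilde y z w1 w2 {t'..n} {t..n} \<le> b n"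
proof -
  let ?f = "\<lambda>i. a i + 1 * of_bool (i \<in> {t'..n})"
  let ?g = "\<lambda>i. b i + 1 * of_bool (i \<in> {t..n})"
  have "1 * ((\<Sum>i\<in>{t'..n}. w1 i * (y i - a i)) + (\<Sum>i\<in>{t..n}. w2 i * (z i - b i))) \<le> 0"
  proof (rule L2_variational_inequality_indicator[OF arg_min, where f = ?f and g = ?g])
    show "mono_on {1..n} ?f"
    proof (rule mono_onI)
      fix i j assume "i \<in> {1..n}" "j \<in> {1..n}" "i \<le> j"
      then show "?f i \<le> ?f j"
        using mono_a[of i j] by (simp add: of_bool_def)
    qed
    show "mono_on {1..n} ?g"
    proof (rule mono_onI)
      fix i j assume "i \<in> {1..n}" "j \<in> {1..n}" "i \<le> j"
      then show "?g i \<le> ?g j"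
        using mono_b[of i j] by (simp add: of_bool_def)
    qed
    show "?f i \<le> ?g i" if "i \<in> {1..n}" for i
      using that a_le_b[of i] assms(1) by (simp add: of_bool_def)
  qed (use assms in simp_all)
  then have sums: "(\<Sum>i\<in>{t'..n}. w1 i * (y i - a i)) + (\<Sum>i\<in>{t..n}. w2 i * (z i - b i)) \<le> 0"
    by (simp only: mult_1_left)
  show ?thesis
  proof (rule M_tilde_leI[OF _ _ _ _ _ sums])
    show "w1 i > 0" "a i \<le> b n" if "i \<in> {t'..n}" for i
      using that assms w1[of i] le_b_last(1)[of i] by simp_all
    show "w2 i > 0" "b i \<le> b n" if "i \<in> {t..n}" for i
      using that assms w2[of i] le_b_last(2)[of i] by simp_all
  qed (use assms in simp_all)
qed

text \<open>The witnesses are the endpoints of the level sets of \<open>a\<close> and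
  \<open>b\<close> at the value \<open>a 1\<close>. The second may be empty, so
  \<open>t' = 0\<close> is possible.\<close>

lemma M_tilde_le_a_first:
  obtains t t' where "t' \<le> t" "1 \<le> t" "t \<le> n" "M_tilde y z w1 w2 {1..t} {1..t'} \<le> a 1"
proof -
  define A where "A = {i \<in> {1..n}. a i = a 1}"
  define B where "B = {i \<in> {1..n}. b i = a 1}"
  have BA: "B \<subseteq> A"
    \<comment> \<open>If \<open>b i = a 1\<close>, then \<open>a i\<close> is squeezed between
      \<open>a 1\<close> and \<open>b i\<close>.\<close>
    unfolding A_def B_def using a_le_b a_first_le by force
  obtain t where t: "t \<le> n" "A = {1..t}"
  proof (rule down_closed_eq_atLeastAtMost[of A n])
    show "i \<in> A" if "j \<in> A" "1 \<le> i" "i \<le> j" for i j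
      using that mono_a[of i j] a_first_le(1)[of i] by (simp add: A_def)
  qed (auto simp: A_def)
  obtain t' where t': "t' \<le> n" "B = {1..t'}"
  proof (rule down_closed_eq_atLeastAtMost[of B n])
    show "i \<in> B" if "j \<in> B" "1 \<le> i" "i \<le> j" for i j
      using that mono_b[of i j] a_first_le(2)[of i] by (simp add: B_def)
  qed (auto simp: B_def)
  have "1 \<in> A"
    using n by (simp add: A_def)
  then have t1: "1 \<le> t"
    using t by simp
  have t't: "t' \<le> t"
    using BA t t' by (cases "t' = 0") (auto dest: subsetD[of _ _ t'])
  \<comment> \<open>No value of \<open>a\<close> or \<open>b\<close> lies strictly between
    \<open>a 1\<close> and \<open>m\<close>. Truncating from below at \<open>m\<close> therefore
    shifts exactly the level sets, by \<open>m - a 1\<close>, and fixes everything else, while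
    \<open>max m\<close> preserves all the constraints.\<close>
  obtain m where m: "a 1 < m" "\<And>v. v \<in> a ` {1..n} \<union> b ` {1..n} \<Longrightarrow> a 1 < v \<Longrightarrow> m \<le> v"
    by (rule finite_gap_above[of "a ` {1..n} \<union> b ` {1..n}" "a 1"]) auto
  let ?f = "\<lambda>i. max m (a i)" and ?g = "\<lambda>i. max m (b i)"
  have "(m - a 1) * ((\<Sum>i\<in>A. w1 i * (y i - a i)) + (\<Sum>i\<in>B. w2 i * (z i - b i))) \<le> 0"
  proof (rule L2_variational_inequality_indicator[OF arg_min, where f = ?f and g = ?g])
    show "mono_on {1..n} ?f" "mono_on {1..n} ?g"
      by (intro mono_onI max.mono order_refl mono_a mono_b; simp)+
    show "?f i \<le> ?g i" if "i \<in> {1..n}" for i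
      using that by (intro max.mono a_le_b) auto
    show "?f i = a i + (m - a 1) * of_bool (i \<in> A)" if "i \<in> {1..n}" for i
      using that m(1) m(2)[of "a i"] a_first_le(1)[of i] by (auto simp: A_def max_def)
    show "?g i = b i + (m - a 1) * of_bool (i \<in> B)" if "i \<in> {1..n}" for i
      using that m(1) m(2)[of "b i"] a_first_le(2)[of i] by (auto simp: B_def max_def)
  qed (auto simp: A_def B_def)
  then have "(\<Sum>i\<in>A. w1 i * (y i - a i)) + (\<Sum>i\<in>B. w2 i * (z i - b i)) \<le> 0"
    using m(1) by (simp add: mult_le_0_iff)
  then have "M_tilde y z w1 w2 A B \<le> a 1"
    using \<open>1 \<in> A\<close> by (intro M_tilde_leI[where a = a and b = b] w1 w2) (auto simp: A_def B_def)
  then show thesis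
    using that t t' t1 t't by simp
qed

text \<open>The order dual, with level sets at \<open>b n\<close>. The set for \<open>a\<close> may
  be empty, in which case \<open>t' = Suc n\<close>.\<close>

lemma b_last_le_M_tilde:
  obtains t t' where "t \<le> t'" "1 \<le> t" "t \<le> n" "t' \<le> Suc n"
    "b n \<le> M_tilde y z w1 w2 {t'..n} {t..n}"
proof -
  define A where "A = {i \<in> {1..n}. a i = b n}"
  define B where "B = {i \<in> {1..n}. b i = b n}"
  have AB: "A \<subseteq> B"
    unfolding A_def B_def using a_le_b le_b_last by force
  obtain t' where t': "1 \<le> t'" "t' \<le> Suc n" "A = {t'..n}"
  proof (rule up_closed_eq_atLeastAtMost[of A n])
    show "j \<in> A" if "i \<in> A" "i \<le> j" "j \<le> n" for i j
      using that mono_a[of i j] le_b_last(1)[of j] by (simp add: A_def)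
  qed (auto simp: A_def)
  obtain t where t: "1 \<le> t" "t \<le> Suc n" "B = {t..n}"
  proof (rule up_closed_eq_atLeastAtMost[of B n])
    show "j \<in> B" if "i \<in> B" "i \<le> j" "j \<le> n" for i j
      using that mono_b[of i j] le_b_last(2)[of j] by (simp add: B_def)
  qed (auto simp: B_def)
  have "n \<in> B"
    using n by (simp add: B_def)
  then have tn: "t \<le> n"
    using t by simp
  have tt': "t \<le> t'"
    using AB t t' by (cases "t' = Suc n") (auto dest: subsetD[of _ _ t'])
  obtain m where m: "m < b n" "\<And>v. v \<in> a ` {1..n} \<union> b ` {1..n} \<Longrightarrow> v < b n \<Longrightarrow> v \<le> m"
    by (rule finite_gap_below[of "a ` {1..n} \<union> b ` {1..n}" "b n"]) auto
  let ?f = "\<lambda>i. min m (a i)" and ?g = "\<lambda>i. min m (b i)"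
  \<comment> \<open>Truncating from above at \<open>m\<close> moves exactly the level sets. The
    shift \<open>m - b n\<close> is negative, so cancelling it reverses the inequality.\<close>
  have "(m - b n) * ((\<Sum>i\<in>A. w1 i * (y i - a i)) + (\<Sum>i\<in>B. w2 i * (z i - b i))) \<le> 0"
  proof (rule L2_variational_inequality_indicator[OF arg_min, where f = ?f and g = ?g])
    show "mono_on {1..n} ?f" "mono_on {1..n} ?g"
      by (intro mono_onI min.mono order_refl mono_a mono_b; simp)+
    show "?f i \<le> ?g i" if "i \<in> {1..n}" for i
      using that by (intro min.mono a_le_b) auto
    show "?f i = a i + (m - b n) * of_bool (i \<in> A)" if "i \<in> {1..n}" for i
      using that m(1) m(2)[of "a i"] le_b_last(1)[of i] by (auto simp: A_def min_def)
    show "?g i = b i + (m - b n) * of_bool (i \<in> B)" if "i \<in> {1..n}" for i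
      using that m(1) m(2)[of "b i"] le_b_last(2)[of i] by (auto simp: B_def min_def)
  qed (auto simp: A_def B_def)
  then have "0 \<le> (\<Sum>i\<in>A. w1 i * (y i - a i)) + (\<Sum>i\<in>B. w2 i * (z i - b i))"
    using m(1) by (simp add: mult_le_0_iff)
  then have "b n \<le> M_tilde y z w1 w2 A B"
    using \<open>n \<in> B\<close> by (intro le_M_tildeI[where a = a and b = b] w1 w2) (auto simp: A_def B_def)
  then show thesis
    using that t t' tn tt' by simp
qed

section \<open>Assembling the two formulas\<close>

lemma a_first_eq_Min:
  "a 1 = min (Min {Av y w1 {1..t} | t. 1 \<le> t \<and> t \<le> n})
             (Min {M_tilde y z w1 w2 {1..t} {1..t'} | t t'. 1 \<le> t' \<and> t' \<le> t \<and> t \<le> n})"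
    (is "_ = min (Min ?S) (Min ?T)")
proof -
  have "?S = (\<lambda>t. Av y w1 {1..t}) ` {1..n}"
    by auto
  also have "\<dots> = (\<lambda>t. M_tilde y z w1 w2 {1..t} {}) ` {1..n}"
    using w1 by (intro image_cong refl M_tilde_empty(1)[symmetric]) auto
  finally have S: "?S = (\<lambda>t. M_tilde y z w1 w2 {1..t} {}) ` {1..n}" .
  have T: "?T = (\<lambda>(t, t'). M_tilde y z w1 w2 {1..t} {1..t'}) ` (SIGMA t:{1..n}. {1..t})"
    by (auto simp: image_iff) force
  have fin: "finite ?S" "finite ?T"
    unfolding S T by (rule finite_imageI, simp)+
  have ne: "?S \<noteq> {}" "?T \<noteq> {}"
    unfolding S T using n by (auto simp: Sigma_empty_iff)
  \<comment> \<open>With \<open>?S\<close> as the case \<open>t' = 0\<close>, both minima merge into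
    a single one over all \<open>t' \<le> t\<close>.\<close>
  have "Min (?S \<union> ?T) = a 1"
  proof (rule antisym)
    obtain t t' where t: "t' \<le> t" "1 \<le> t" "t \<le> n" "M_tilde y z w1 w2 {1..t} {1..t'} \<le> a 1"
      by (rule M_tilde_le_a_first)
    then have "M_tilde y z w1 w2 {1..t} {1..t'} \<in> ?S \<union> ?T"
      unfolding S T by (cases "t' = 0") auto
    then show "Min (?S \<union> ?T) \<le> a 1"
      using fin t(4) by (intro Min.coboundedI[THEN order_trans]) auto
    show "a 1 \<le> Min (?S \<union> ?T)"
    proof (rule Min.boundedI)
      fix v assume "v \<in> ?S \<union> ?T"
      \<comment> \<open>The empty set is spelled \<open>{1..0}\<close> so that the bound for general
        \<open>t'\<close> applies verbatim.\<close>
      then consider t where "t \<in> {1..n}" "v = M_tilde y z w1 w2 {1..t} {1..0}"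
        | t t' where "t \<in> {1..n}" "t' \<in> {1..t}" "v = M_tilde y z w1 w2 {1..t} {1..t'}"
        unfolding S T by auto
      then show "a 1 \<le> v"
        by cases (simp_all only: a_first_le_M_tilde atLeastAtMost_iff le0)
    qed (use fin ne in auto)
  qed
  then show ?thesis
    using Min.union[OF fin(1) ne(1) fin(2) ne(2)] by simp
qed

lemma b_last_eq_Max:
  "b n = max (Max {Av z w2 {t..n} | t. 1 \<le> t \<and> t \<le> n})
             (Max {M_tilde y z w1 w2 {t'..n} {t..n} | t t'. 1 \<le> t \<and> t \<le> t' \<and> t' \<le> n})"
    (is "_ = max (Max ?S) (Max ?T)")
proof -
  have "?S = (\<lambda>t. Av z w2 {t..n}) ` {1..n}"
    by auto
  also have "\<dots> = (\<lambda>t. M_tilde y z w1 w2 {} {t..n}) ` {1..n}"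
    using w2 by (intro image_cong refl M_tilde_empty(2)[symmetric]) auto
  finally have S: "?S = (\<lambda>t. M_tilde y z w1 w2 {} {t..n}) ` {1..n}" .
  have T: "?T = (\<lambda>(t, t'). M_tilde y z w1 w2 {t'..n} {t..n}) ` (SIGMA t:{1..n}. {t..n})"
    by (auto simp: image_iff) force
  have fin: "finite ?S" "finite ?T"
    unfolding S T by (rule finite_imageI, simp)+
  have ne: "?S \<noteq> {}" "?T \<noteq> {}"
    unfolding S T using n by (auto simp: Sigma_empty_iff)
  have "Max (?S \<union> ?T) = b n"
  proof (rule antisym)
    obtain t t' where t: "t \<le> t'" "1 \<le> t" "t \<le> n" "t' \<le> Suc n"
      "b n \<le> M_tilde y z w1 w2 {t'..n} {t..n}"
      by (rule b_last_le_M_tilde)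
    then have "M_tilde y z w1 w2 {t'..n} {t..n} \<in> ?S \<union> ?T"
      unfolding S T by (cases "t' = Suc n") auto
    then show "b n \<le> Max (?S \<union> ?T)"
      using fin t(5) by (intro Max.coboundedI[THEN order_trans[rotated]]) auto
    show "Max (?S \<union> ?T) \<le> b n"
    proof (rule Max.boundedI)
      fix v assume "v \<in> ?S \<union> ?T"
      \<comment> \<open>Likewise \<open>{Suc n..n}\<close> stands for the empty set, matching the
        bound with \<open>t' = Suc n\<close>.\<close>
      then consider t where "t \<in> {1..n}" "v = M_tilde y z w1 w2 {Suc n..n} {t..n}"
        | t t' where "t \<in> {1..n}" "t' \<in> {t..n}" "v = M_tilde y z w1 w2 {t'..n} {t..n}"
        unfolding S T by auto
      then show "v \<le> b n"
        by cases (simp_all only: M_tilde_le_b_last atLeastAtMost_iff le_SucI)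
    qed (use fin ne in auto)
  qed
  then show ?thesis
    using Max.union[OF fin(1) ne(1) fin(2) ne(2)] by simp
qed

end

theorem proposition2p3:
  fixes n :: nat and y z w1 w2 a b :: "nat \<Rightarrow> real"
  assumes "n \<ge> 1"
    and "\<And>i. i \<in> {1..n} \<Longrightarrow> w1 i > 0"
    and "\<And>i. i \<in> {1..n} \<Longrightarrow> w2 i > 0"
    and "is_arg_min (L2 n y z w1 w2) (\<lambda>p. p \<in> ordered_isotonic_pairs n) (a, b)"
  shows "a 1 =
           min (Min {Av y w1 {1..t} | t. 1 \<le> t \<and> t \<le> n})
               (Min {M_tilde y z w1 w2 {1..t} {1..t'} | t t'. 1 \<le> t' \<and> t' \<le> t \<and> t \<le> n}) \<and>
         b n =
           max (Max {Av z w2 {t..n} | t. 1 \<le> t \<and> t \<le> n})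
               (Max {M_tilde y z w1 w2 {t'..n} {t..n} | t t'. 1 \<le> t \<and> t \<le> t' \<and> t' \<le> n})"
  using a_first_eq_Min[OF assms] b_last_eq_Max[OF assms] by (rule conjI)

end
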